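(* Let $\mathfrak{L}$ be a right Leibniz algebra over a field $\mathbb{F}$. Then the following statements are equivalent: (i) $\mathfrak{L}$ is solvable. (ii) $\mathfrak{L}_{\mathrm{Lie}}$ is solvable. (iii) $\mathfrak{L}/C_r(\mathfrak{L})$ is solvable. (iv) $R(\mathfrak{L})$ is solvable.
   Context: An algebra over a field $\mathbb{F}$ is an $\mathbb{F}$-vector space (of arbitrary dimension) with a bilinear multiplication $(x,y)\mapsto xy$, not assumed associative. A right Leibniz algebra is an algebra $\mathfrak{L}$ with $(xy)z=(xz)y+x(yz)$ for all $x,y,z\in\mathfrak{L}$. For an algebra $\mathfrak{A}$, the derived series is $\mathfrak{A}^{(0)}:=\mathfrak{A}$, $\mathfrak{A}^{(n+1)}:=\mathfrak{A}^{(n)}\mathfrak{A}^{(n)}$, where a product of two subspaces denotes the linear span of all products of their elements; $\mathfrak{A}$ is solvable if $\mathfrak{A}^{(r)}=0$ for some non-negative integer $r$ (Lie algebras are regarded as algebras via their bracket). The Leibniz kernel $\mathrm{Leib}(\mathfrak{L})$ is the $\mathbb{F}$-span of $\{x^2=xx\mid x\in\mathfrak{L}\}$; it is a (two-sided) ideal, and $\mathfrak{L}_{\mathrm{Lie}}:=\mathfrak{L}/\mathrm{Leib}(\mathfrak{L})$ is the canonical Lie algebra associated to $\mathfrak{L}$. The right center is $C_r(\mathfrak{L}):=\{c\in\mathfrak{L}\mid xc=0\text{ for all }x\in\mathfrak{L}\}$, which is an ideal of $\mathfrak{L}$. For $a\in\mathfrak{L}$ let $R_a:\mathfrak{L}\to\mathfrak{L}$,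 $x\mapsto xa$; $R(\mathfrak{L}):=\{R_a\mid a\in\mathfrak{L}\}$, which is a Lie subalgebra of $\mathfrak{gl}(\mathfrak{L})$ (all linear operators on $\mathfrak{L}$ with the commutator bracket). *)

theory Defs
  imports "HOL-Algebra.Module" "HOL-Algebra.QuotRing"
begin

text \<open>
  Algebras over a field are represented by the library's \<^type>\<open>module_scheme\<close> record, whose
  \<^const>\<open>mult\<close> field holds the (in general non-associative) product. The \<^const>\<open>one\<close> field of
  that record carries no meaning here.
\<close>

locale nonassoc_algebra = field F + module F A for F and A (structure) +
  assumes mult_closed:
      "\<lbrakk>x \<in> carrier A; y \<in> carrier A\<rbrakk> \<Longrightarrow> x \<otimes> y \<in> carrier A"
    and mult_add_left:
      "\<lbrakk>x \<in> carrier A; y \<in> carrier A; z \<in> carrier A\<rbrakk> \<Longrightarrow>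
        (x \<oplus> y) \<otimes> z = x \<otimes> z \<oplus> y \<otimes> z"
    and mult_add_right:
      "\<lbrakk>x \<in> carrier A; y \<in> carrier A; z \<in> carrier A\<rbrakk> \<Longrightarrow>
        x \<otimes> (y \<oplus> z) = x \<otimes> y \<oplus> x \<otimes> z"
    and mult_smult_left:
      "\<lbrakk>a \<in> carrier F; x \<in> carrier A; y \<in> carrier A\<rbrakk> \<Longrightarrow>
        (a \<odot> x) \<otimes> y = a \<odot> (x \<otimes> y)"
    and mult_smult_right:
      "\<lbrakk>a \<in> carrier F; x \<in> carrier A; y \<in> carrier A\<rbrakk> \<Longrightarrow>
        x \<otimes> (a \<odot> y) = a \<odot> (x \<otimes> y)"

locale right_leibniz_algebra = nonassoc_algebra F A for F and A (structure) +
  assumes right_leibniz: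
    "\<lbrakk>x \<in> carrier A; y \<in> carrier A; z \<in> carrier A\<rbrakk> \<Longrightarrow>
      (x \<otimes> y) \<otimes> z = (x \<otimes> z) \<otimes> y \<oplus> x \<otimes> (y \<otimes> z)"

text \<open>The linear span, as the smallest subspace containing \<open>S\<close>.\<close>

definition lin_span ::
    "('f, 'p) ring_scheme \<Rightarrow> ('f, 'a, 'q) module_scheme \<Rightarrow> 'a set \<Rightarrow> 'a set"
  where "lin_span F A S = \<Inter>{H. submodule H F A \<and> S \<subseteq> H}"

definition subspace_prod ::
    "('f, 'p) ring_scheme \<Rightarrow> ('f, 'a, 'q) module_scheme \<Rightarrow> 'a set \<Rightarrow> 'a set \<Rightarrow> 'a set"
  where "subspace_prod F A U V = lin_span F A {u \<otimes>\<^bsub>A\<^esub> v | u v. u \<in> U \<and> v \<in> V}"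

primrec derived_series ::
    "('f, 'p) ring_scheme \<Rightarrow> ('f, 'a, 'q) module_scheme \<Rightarrow> nat \<Rightarrow> 'a set"
  where
    "derived_series F A 0 = carrier A"
  | "derived_series F A (Suc n) =
       subspace_prod F A (derived_series F A n) (derived_series F A n)"

definition solvable_algebra ::
    "('f, 'p) ring_scheme \<Rightarrow> ('f, 'a, 'q) module_scheme \<Rightarrow> bool"
  where "solvable_algebra F A \<longleftrightarrow> (\<exists>r. derived_series F A r = {\<zero>\<^bsub>A\<^esub>})"

text \<open>
  The quotient of an algebra by a two-sided ideal \<open>I\<close>: as in \<^const>\<open>FactRing\<close>, the elements are
  the additive cosets of \<open>I\<close>. Scalar multiplication is \<open>c (x + I) = c x + I\<close>, written as a union
  over representatives, so that it is also right for \<open>c = 0\<close>.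
\<close>

definition quotient_algebra ::
    "('f, 'a, 'q) module_scheme \<Rightarrow> 'a set \<Rightarrow> ('f, 'a set) module"
  where "quotient_algebra A I =
    \<lparr>carrier = a_rcosets\<^bsub>A\<^esub> I, mult = rcoset_mult A I, one = undefined,
     zero = I, add = set_add A, smult = (\<lambda>c S. \<Union>x\<in>S. I +>\<^bsub>A\<^esub> (c \<odot>\<^bsub>A\<^esub> x))\<rparr>"

definition leibniz_kernel ::
    "('f, 'p) ring_scheme \<Rightarrow> ('f, 'a, 'q) module_scheme \<Rightarrow> 'a set"
  where "leibniz_kernel F L = lin_span F L {x \<otimes>\<^bsub>L\<^esub> x | x. x \<in> carrier L}"

definition canonical_lie ::
    "('f, 'p) ring_scheme \<Rightarrow> ('f, 'a, 'q) module_scheme \<Rightarrow> ('f, 'a set) module"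
  where "canonical_lie F L = quotient_algebra L (leibniz_kernel F L)"

definition right_center :: "('f, 'a, 'q) module_scheme \<Rightarrow> 'a set"
  where "right_center L = {c \<in> carrier L. \<forall>x \<in> carrier L. x \<otimes>\<^bsub>L\<^esub> c = \<zero>\<^bsub>L\<^esub>}"

text \<open>
  Operators on \<open>carrier A\<close> are represented as extensional functions, so that equality of
  operators is equality of functions.
\<close>

definition linear_operators ::
    "('f, 'p) ring_scheme \<Rightarrow> ('f, 'a, 'q) module_scheme \<Rightarrow> ('a \<Rightarrow> 'a) set"
  where "linear_operators F A =
    {f \<in> carrier A \<rightarrow>\<^sub>E carrier A.
       (\<forall>x \<in> carrier A. \<forall>y \<in> carrier A. f (x \<oplus>\<^bsub>A\<^esub> y) = f x \<oplus>\<^bsub>A\<^esub> f y) \<and>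
       (\<forall>c \<in> carrier F. \<forall>x \<in> carrier A. f (c \<odot>\<^bsub>A\<^esub> x) = c \<odot>\<^bsub>A\<^esub> f x)}"

definition gl ::
    "('f, 'p) ring_scheme \<Rightarrow> ('f, 'a, 'q) module_scheme \<Rightarrow> ('f, 'a \<Rightarrow> 'a) module"
  where "gl F A =
    \<lparr>carrier = linear_operators F A,
     mult = (\<lambda>f g. \<lambda>x \<in> carrier A. f (g x) \<ominus>\<^bsub>A\<^esub> g (f x)),
     one = undefined,
     zero = (\<lambda>x \<in> carrier A. \<zero>\<^bsub>A\<^esub>),
     add = (\<lambda>f g. \<lambda>x \<in> carrier A. f x \<oplus>\<^bsub>A\<^esub> g x),
     smult = (\<lambda>c f. \<lambda>x \<in> carrier A. c \<odot>\<^bsub>A\<^esub> f x)\<rparr>"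

definition right_mult_op :: "('f, 'a, 'q) module_scheme \<Rightarrow> 'a \<Rightarrow> 'a \<Rightarrow> 'a"
  where "right_mult_op L a = (\<lambda>x \<in> carrier L. x \<otimes>\<^bsub>L\<^esub> a)"

text \<open>\<open>R(L)\<close>, with the operations inherited from \<open>gl(L)\<close>.\<close>

definition right_mult_algebra ::
    "('f, 'p) ring_scheme \<Rightarrow> ('f, 'a, 'q) module_scheme \<Rightarrow> ('f, 'a \<Rightarrow> 'a) module"
  where "right_mult_algebra F L = (gl F L)\<lparr>carrier := right_mult_op L ` carrier L\<rparr>"

end

theory Submission
  imports Defs
begin

text \<open>
  All three equivalences are instances of one fact: if \<open>h\<close> is a homomorphism from \<open>A\<close> onto \<open>B\<close>
  whose kernel lies in the right center, then \<open>A\<close> is solvable iff \<open>B\<close> is. Indeed \<open>h\<close> maps the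
  derived series of \<open>A\<close> onto that of \<open>B\<close>; so if the \<open>r\<close>-th term vanishes in \<open>B\<close>, then in \<open>A\<close> it
  lies in the right center, and hence the next term is zero. The Leibniz identity
  with \<open>y = z\<close> puts \<open>Leib(L)\<close> in the right center. It also gives \<open>[R\<^sub>a, R\<^sub>b] = R\<^bsub>ba\<^esub>\<close>, so that
  \<open>a \<mapsto> R\<^bsub>-a\<^esub>\<close> is a homomorphism, with the right center as its kernel.
\<close>

section \<open>Linear spans\<close>

context module
begin

lemma uminus_eq_smult:
  assumes "x \<in> carrier M"
  shows "\<ominus>\<^bsub>M\<^esub> x = (\<ominus> \<one>) \<odot>\<^bsub>M\<^esub> x"
  using assms by (simp add: smult_l_minus)

text \<open>Negation is scaling by \<open>\<ominus> \<one>\<close>, so the closure under additive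
  inverses demanded by \<open>submoduleI\<close> comes from closure under scalars.\<close>

lemma submoduleI_smult:
  assumes "H \<subseteq> carrier M" and "\<zero>\<^bsub>M\<^esub> \<in> H"
    and "\<And>x y. \<lbrakk>x \<in> H; y \<in> H\<rbrakk> \<Longrightarrow> x \<oplus>\<^bsub>M\<^esub> y \<in> H"
    and "\<And>a x. \<lbrakk>a \<in> carrier R; x \<in> H\<rbrakk> \<Longrightarrow> a \<odot>\<^bsub>M\<^esub> x \<in> H"
  shows "submodule H R M"
  using assms by (intro submoduleI) (auto simp: uminus_eq_smult subset_iff)

lemma minus_zero: "\<ominus>\<^bsub>M\<^esub> \<zero>\<^bsub>M\<^esub> = \<zero>\<^bsub>M\<^esub>"
  by (simp add: uminus_eq_smult)

lemma zero_in_submodule: "submodule H R M \<Longrightarrow> \<zero>\<^bsub>M\<^esub> \<in> H"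
  by (metis submodule_def subgroup.one_closed monoid.select_convs(2))

lemma zero_submodule: "submodule {\<zero>\<^bsub>M\<^esub>} R M"
  by (rule submoduleI_smult) auto

lemma lin_span_superset: "S \<subseteq> lin_span R M S"
  unfolding lin_span_def by blast

lemma lin_span_least: "\<lbrakk>submodule H R M; S \<subseteq> H\<rbrakk> \<Longrightarrow> lin_span R M S \<subseteq> H"
  unfolding lin_span_def by blast

text \<open>The intersected family contains \<open>carrier M\<close>, which keeps the span inside
  the carrier; the closure properties pass to intersections.\<close>

lemma lin_span_submodule:
  assumes "S \<subseteq> carrier M"
  shows "submodule (lin_span R M S) R M"
proof (rule submoduleI_smult)
  show "lin_span R M S \<subseteq> carrier M"
    using carrier_is_submodule assms by (rule lin_span_least)
qed (auto simp: lin_span_def zero_in_submodule submoduleE)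

end

section \<open>Surjective homomorphisms\<close>

text \<open>\<open>B\<close> is a bare record about which no axioms are assumed. Hence
  \<open>hom_zero\<close> is a separate condition: it ties the \<open>zero\<close> field of
  \<open>B\<close> to the image of zero, which additivity alone would not do.\<close>

locale surj_algebra_hom = nonassoc_algebra F A for F and A (structure) +
  fixes B :: "('f, 'b, 'r) module_scheme" and h
  assumes surj: "h ` carrier A = carrier B"
    and hom_zero: "h \<zero> = \<zero>\<^bsub>B\<^esub>"
    and hom_add: "\<lbrakk>x \<in> carrier A; y \<in> carrier A\<rbrakk> \<Longrightarrow> h (x \<oplus> y) = h x \<oplus>\<^bsub>B\<^esub> h y"
    and hom_smult: "\<lbrakk>a \<in> carrier F; x \<in> carrier A\<rbrakk> \<Longrightarrow> h (a \<odot> x) = a \<odot>\<^bsub>B\<^esub> h x"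
    and hom_mult: "\<lbrakk>x \<in> carrier A; y \<in> carrier A\<rbrakk> \<Longrightarrow> h (x \<otimes> y) = h x \<otimes>\<^bsub>B\<^esub> h y"
begin

lemma hom_in: "x \<in> carrier A \<Longrightarrow> h x \<in> carrier B"
  using surj by blast

lemma preimage:
  assumes "y \<in> carrier B"
  obtains x where "x \<in> carrier A" "y = h x"
  using assms surj by blast

text \<open>Every element of \<open>B\<close> is an image, so each module axiom is inherited from
  \<open>A\<close>. This covers the quotients and the operator algebra at once, without checking the
  axioms for each.\<close>

lemma codomain_module: "module F B"
proof (rule moduleI)
  show "cring F" by (rule is_cring)
  show "abelian_group B"
  proof (rule abelian_groupI)
    show "\<And>x y. \<lbrakk>x \<in> carrier B; y \<in> carrier B\<rbrakk> \<Longrightarrow> x \<oplus>\<^bsub>B\<^esub> y \<in> carrier B"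
      by (elim preimage) (simp flip: hom_add add: hom_in)
    show "\<zero>\<^bsub>B\<^esub> \<in> carrier B"
      by (metis hom_zero hom_in M.zero_closed)
    show "\<And>x y z. \<lbrakk>x \<in> carrier B; y \<in> carrier B; z \<in> carrier B\<rbrakk>
        \<Longrightarrow> (x \<oplus>\<^bsub>B\<^esub> y) \<oplus>\<^bsub>B\<^esub> z = x \<oplus>\<^bsub>B\<^esub> (y \<oplus>\<^bsub>B\<^esub> z)"
      by (elim preimage) (simp flip: hom_add add: M.a_assoc)
    show "\<And>x y. \<lbrakk>x \<in> carrier B; y \<in> carrier B\<rbrakk> \<Longrightarrow> x \<oplus>\<^bsub>B\<^esub> y = y \<oplus>\<^bsub>B\<^esub> x"
      by (elim preimage) (simp flip: hom_add add: M.a_comm)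
    show "\<And>x. x \<in> carrier B \<Longrightarrow> \<zero>\<^bsub>B\<^esub> \<oplus>\<^bsub>B\<^esub> x = x"
      by (elim preimage) (simp flip: hom_add hom_zero)
    show "\<exists>y\<in>carrier B. y \<oplus>\<^bsub>B\<^esub> x = \<zero>\<^bsub>B\<^esub>" if x: "x \<in> carrier B" for x
    proof -
      obtain a where a: "a \<in> carrier A" "x = h a"
        using x by (rule preimage)
      then have "h (\<ominus> a) \<oplus>\<^bsub>B\<^esub> x = \<zero>\<^bsub>B\<^esub>"
        by (metis hom_add hom_zero M.l_neg M.a_inv_closed)
      moreover have "h (\<ominus> a) \<in> carrier B"
        using a by (simp add: hom_in)
      ultimately show ?thesis
        by blast
    qed
  qed
  show "\<And>a x. \<lbrakk>a \<in> carrier F; x \<in> carrier B\<rbrakk> \<Longrightarrow> a \<odot>\<^bsub>B\<^esub> x \<in> carrier B"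
    by (elim preimage) (simp flip: hom_smult add: hom_in)
qed (elim preimage; simp flip: hom_add hom_smult
      add: smult_l_distr smult_r_distr smult_assoc1)+

lemma submodule_preimage:
  assumes "submodule H F B"
  shows "submodule {x \<in> carrier A. h x \<in> H} F A"
proof -
  interpret B: module F B by (rule codomain_module)
  show ?thesis
    by (rule submoduleI_smult)
      (auto simp: hom_zero hom_add hom_smult B.submoduleE(4,5)[OF assms] B.zero_in_submodule[OF assms])
qed

lemma submodule_image:
  assumes "submodule H F A"
  shows "submodule (h ` H) F B"
proof -
  interpret B: module F B by (rule codomain_module)
  note H = submoduleE[OF assms] zero_in_submodule[OF assms]
  show ?thesis
  proof (rule B.submoduleI_smult)
    show "h ` H \<subseteq> carrier B"
      using H(1) hom_in by blast
    show "\<zero>\<^bsub>B\<^esub> \<in> h ` H"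
      using H(7) hom_zero by (metis imageI)
    show "x \<oplus>\<^bsub>B\<^esub> y \<in> h ` H" if "x \<in> h ` H" "y \<in> h ` H" for x y
      using that H(1,5) hom_add by (smt (verit) image_iff subsetD)
    show "a \<odot>\<^bsub>B\<^esub> x \<in> h ` H" if "a \<in> carrier F" "x \<in> h ` H" for a x
      using that H(1,4) hom_smult by (smt (verit) image_iff subsetD)
  qed
qed

text \<open>Both inclusions follow from minimality of spans: the preimage of the span of
  \<open>h\<close>
  S\<open>is a submodule containing\<close>S\<open>, and the image of the span of\<close>S\<open>is a submodule containing\<close>h
  \<open>S\<close>.\<close>

lemma image_lin_span:
  assumes "S \<subseteq> carrier A"
  shows "h ` lin_span F A S = lin_span F B (h ` S)"
proof
  interpret B: module F B by (rule codomain_module)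
  have "h ` S \<subseteq> carrier B"
    using assms hom_in by blast
  then have "submodule {x \<in> carrier A. h x \<in> lin_span F B (h ` S)} F A"
    by (intro submodule_preimage B.lin_span_submodule)
  moreover have "S \<subseteq> {x \<in> carrier A. h x \<in> lin_span F B (h ` S)}"
    using assms B.lin_span_superset[of "h ` S"] by blast
  ultimately show "h ` lin_span F A S \<subseteq> lin_span F B (h ` S)"
    using lin_span_least by blast
  show "lin_span F B (h ` S) \<subseteq> h ` lin_span F A S"
    using lin_span_submodule[OF assms] lin_span_superset[of S]
    by (intro B.lin_span_least submodule_image image_mono)
qed

end

section \<open>Derived series\<close>

context nonassoc_algebra
begin

lemma mult_zero_right: "x \<in> carrier A \<Longrightarrow> x \<otimes> \<zero> = \<zero>"
  using mult_smult_right[of "\<zero>\<^bsub>F\<^esub>" x \<zero>] by (simp add: mult_closed)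

lemma mult_zero_left: "x \<in> carrier A \<Longrightarrow> \<zero> \<otimes> x = \<zero>"
  using mult_smult_left[of "\<zero>\<^bsub>F\<^esub>" \<zero> x] by (simp add: mult_closed)

lemma mult_minus_right: "\<lbrakk>x \<in> carrier A; y \<in> carrier A\<rbrakk> \<Longrightarrow> x \<otimes> (\<ominus> y) = \<ominus> (x \<otimes> y)"
  by (simp add: uminus_eq_smult mult_smult_right mult_closed)

lemma mult_minus_left: "\<lbrakk>x \<in> carrier A; y \<in> carrier A\<rbrakk> \<Longrightarrow> (\<ominus> x) \<otimes> y = \<ominus> (x \<otimes> y)"
  by (simp add: uminus_eq_smult mult_smult_left mult_closed)

lemma derived_series_submodule: "submodule (derived_series F A n) F A"
proof (induction n)
  case 0
  show ?case using carrier_is_submodule by simp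
next
  case (Suc n)
  have "derived_series F A n \<subseteq> carrier A"
    using Suc by (rule submoduleE)
  then have "{u \<otimes> v |u v. u \<in> derived_series F A n \<and> v \<in> derived_series F A n} \<subseteq> carrier A"
    by (auto intro: mult_closed)
  then show ?case
    by (simp add: subspace_prod_def lin_span_submodule)
qed

lemma derived_series_subset: "derived_series F A n \<subseteq> carrier A"
  using derived_series_submodule by (rule submoduleE)

end

context surj_algebra_hom
begin

text \<open>Since \<open>h\<close> commutes with spans, it is enough at each step that it carries
  the set of products of one term onto the set of products of its image.\<close>

lemma image_derived_series: "h ` derived_series F A n = derived_series F B n"
proof (induction n)
  case 0
  show ?case using surj by simp
next
  case (Suc n)
  let ?D = "derived_series F A n"
  let ?P = "{u \<otimes> v |u v. u \<in> ?D \<and> v \<in> ?D}"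
  have D: "?D \<subseteq> carrier A"
    by (rule derived_series_subset)
  then have "?P \<subseteq> carrier A"
    by (auto intro: mult_closed)
  moreover have "h ` ?P = {u \<otimes>\<^bsub>B\<^esub> v |u v. u \<in> h ` ?D \<and> v \<in> h ` ?D}"
  proof
    show "h ` ?P \<subseteq> {u \<otimes>\<^bsub>B\<^esub> v |u v. u \<in> h ` ?D \<and> v \<in> h ` ?D}"
    proof clarify
      fix u v assume "u \<in> ?D" "v \<in> ?D"
      then show "\<exists>u' v'. h (u \<otimes> v) = u' \<otimes>\<^bsub>B\<^esub> v' \<and> u' \<in> h ` ?D \<and> v' \<in> h ` ?D"
        using D by (intro exI[of _ "h u"] exI[of _ "h v"]) (auto simp: hom_mult subset_iff)
    qed
    show "{u \<otimes>\<^bsub>B\<^esub> v |u v. u \<in> h ` ?D \<and> v \<in> h ` ?D} \<subseteq> h ` ?P"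
    proof clarify
      fix u v assume "u \<in> ?D" "v \<in> ?D"
      then have "h u \<otimes>\<^bsub>B\<^esub> h v = h (u \<otimes> v)" and "u \<otimes> v \<in> ?P"
        using D by (auto simp: hom_mult subset_iff)
      then show "h u \<otimes>\<^bsub>B\<^esub> h v \<in> h ` ?P"
        by (rule image_eqI)
    qed
  qed
  ultimately have "h ` lin_span F A ?P =
      lin_span F B {u \<otimes>\<^bsub>B\<^esub> v |u v. u \<in> h ` ?D \<and> v \<in> h ` ?D}"
    by (simp only: image_lin_span)
  then show ?case
    by (simp only: derived_series.simps subspace_prod_def Suc)
qed

lemma solvable_iff:
  assumes kernel: "\<And>x. \<lbrakk>x \<in> carrier A; h x = \<zero>\<^bsub>B\<^esub>\<rbrakk> \<Longrightarrow> x \<in> right_center A"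
  shows "solvable_algebra F A \<longleftrightarrow> solvable_algebra F B"
proof
  assume "solvable_algebra F A"
  then obtain r where "derived_series F A r = {\<zero>}"
    unfolding solvable_algebra_def by blast
  then have "derived_series F B r = {\<zero>\<^bsub>B\<^esub>}"
    using image_derived_series[of r] by (simp add: hom_zero)
  then show "solvable_algebra F B"
    unfolding solvable_algebra_def by blast
next
  assume "solvable_algebra F B"
  then obtain r where "derived_series F B r = {\<zero>\<^bsub>B\<^esub>}"
    unfolding solvable_algebra_def by blast
  then have "h ` derived_series F A r = {\<zero>\<^bsub>B\<^esub>}"
    by (simp add: image_derived_series)
  then have "h x = \<zero>\<^bsub>B\<^esub>" if "x \<in> derived_series F A r" for x
    using that by (metis imageI singletonD)
  then have "x \<in> right_center A" if "x \<in> derived_series F A r" for x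
    using that derived_series_subset[of r] by (simp add: kernel subset_iff)
  \<comment> \<open>The right factor \<open>v\<close> is annihilated from the left by the whole
    algebra, so all these products vanish. This costs one further term of the series.\<close>
  then have "{u \<otimes> v |u v. u \<in> derived_series F A r \<and> v \<in> derived_series F A r} \<subseteq> {\<zero>}"
    using derived_series_subset[of r] by (auto simp: right_center_def subset_iff)
  then have "derived_series F A (Suc r) \<subseteq> {\<zero>}"
    unfolding derived_series.simps subspace_prod_def by (rule lin_span_least[OF zero_submodule])
  then have "derived_series F A (Suc r) = {\<zero>}"
    using zero_in_submodule[OF derived_series_submodule[of "Suc r"]] by blast
  then show "solvable_algebra F A"
    unfolding solvable_algebra_def by blast
qed

end

section \<open>Quotients\<close>

context nonassoc_algebra
begin

lemma quotient_surj_algebra_hom: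
  assumes I: "submodule I F A"
    and ideal_left: "\<And>x y. \<lbrakk>x \<in> carrier A; y \<in> I\<rbrakk> \<Longrightarrow> x \<otimes> y \<in> I"
    and ideal_right: "\<And>x y. \<lbrakk>x \<in> I; y \<in> carrier A\<rbrakk> \<Longrightarrow> x \<otimes> y \<in> I"
  shows "surj_algebra_hom F A (quotient_algebra A I) (\<lambda>x. I +> x)"
proof -
  note I' = submoduleE[OF I]
  have sub: "subgroup I (add_monoid A)"
    using I by (simp add: submodule_def)
  interpret I: abelian_subgroup I A
    using sub by (intro abelian_subgroupI3 additive_subgroupI M.abelian_group_axioms)
  have coset_eqI: "I +> y = I +> x" if "x \<in> carrier A" "i \<in> I" "y = i \<oplus> x" for i x y
    using that sub I'(1) by (metis M.a_repr_independence M.a_rcosI)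
  have cosetE: "\<exists>i\<in>I. y = i \<oplus> x" if "y \<in> I +> x" for x y
    using that unfolding a_r_coset_def' by blast
  have self: "x \<in> I +> x" if "x \<in> carrier A" for x
    using that by (rule I.a_rcos_self)
  have IA: "i \<in> carrier A" if "i \<in> I" for i
    using that I'(1) by blast
  \<comment> \<open>All members of the union are the same coset, and the union is nonempty because
    \<open>x\<close> represents its own coset; so it collapses. The product of cosets below is
    treated the same way.\<close>
  have smult: "(\<Union>y\<in>I +> x. I +> (a \<odot> y)) = I +> (a \<odot> x)"
    if a: "a \<in> carrier F" and x: "x \<in> carrier A" for a x
  proof -
    have "I +> (a \<odot> y) = I +> (a \<odot> x)" if y: "y \<in> I +> x" for y
    proof -
      obtain i where "i \<in> I" "y = i \<oplus> x"
        using cosetE[OF y] by blast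
      then show ?thesis
        using a x by (intro coset_eqI[of _ "a \<odot> i"]) (auto simp: smult_r_distr IA I')
    qed
    then show ?thesis
      using self[OF x] by blast
  qed
  have mult: "rcoset_mult A I (I +> x) (I +> y) = I +> (x \<otimes> y)"
    if x: "x \<in> carrier A" and y: "y \<in> carrier A" for x y
  proof -
    have "I +> (u \<otimes> v) = I +> (x \<otimes> y)" if uv: "u \<in> I +> x" "v \<in> I +> y" for u v
    proof -
      obtain i j where i: "i \<in> I" "u = i \<oplus> x" and j: "j \<in> I" "v = j \<oplus> y"
        using cosetE[OF uv(1)] cosetE[OF uv(2)] by blast
      \<comment> \<open>Expanding \<open>(i \<oplus> x) \<otimes> (j \<oplus> y)\<close> leaves
        three error terms; they lie in \<open>I\<close> because it absorbs products on both
        sides.\<close>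
      have "u \<otimes> v = (i \<otimes> j \<oplus> i \<otimes> y \<oplus> x \<otimes> j) \<oplus> x \<otimes> y"
        using i j x y by (simp add: mult_add_left mult_add_right mult_closed IA M.a_ac)
      moreover have "i \<otimes> j \<oplus> i \<otimes> y \<oplus> x \<otimes> j \<in> I"
        using i j x y by (simp add: ideal_left ideal_right IA)
      ultimately show ?thesis
        using x y by (intro coset_eqI) (simp_all add: mult_closed)
    qed
    then show ?thesis
      using self[OF x] self[OF y] unfolding rcoset_mult_def by blast
  qed
  show ?thesis
  proof unfold_locales
    show "(\<lambda>x. I +> x) ` carrier A = carrier (quotient_algebra A I)"
      by (auto simp: quotient_algebra_def A_RCOSETS_def')
    show "I +> \<zero> = \<zero>\<^bsub>quotient_algebra A I\<^esub>"
      using I'(1) by (simp add: quotient_algebra_def)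
  qed (simp_all add: quotient_algebra_def I.a_rcos_sum smult mult)
qed

text \<open>The kernel of the projection is \<open>I\<close>, so the kernel condition of
  \<open>solvable_iff\<close> turns into the inclusion of \<open>I\<close> in the right
  center.\<close>

lemma solvable_quotient_iff:
  assumes I: "submodule I F A"
    and ideal_left: "\<And>x y. \<lbrakk>x \<in> carrier A; y \<in> I\<rbrakk> \<Longrightarrow> x \<otimes> y \<in> I"
    and ideal_right: "\<And>x y. \<lbrakk>x \<in> I; y \<in> carrier A\<rbrakk> \<Longrightarrow> x \<otimes> y \<in> I"
    and "I \<subseteq> right_center A"
  shows "solvable_algebra F A \<longleftrightarrow> solvable_algebra F (quotient_algebra A I)"
proof -
  interpret surj_algebra_hom F A "quotient_algebra A I" "\<lambda>x. I +> x"
    using assms by (intro quotient_surj_algebra_hom)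
  have sub: "subgroup I (add_monoid A)"
    using I by (simp add: submodule_def)
  show ?thesis
  proof (rule solvable_iff)
    fix x assume "x \<in> carrier A" "I +> x = \<zero>\<^bsub>quotient_algebra A I\<^esub>"
    then have "x \<in> I"
      using sub M.a_coset_join1[of I x] by (simp add: quotient_algebra_def)
    then show "x \<in> right_center A"
      using assms(4) by blast
  qed
qed

end

section \<open>Leibniz algebras\<close>

context right_leibniz_algebra
begin

section \<open>The right center as an ideal\<close>

lemma right_center_submodule: "submodule (right_center A) F A"
  by (rule submoduleI_smult)
    (auto simp: right_center_def mult_zero_right mult_add_right mult_smult_right)

lemma mult_right_center: "\<lbrakk>x \<in> carrier A; c \<in> right_center A\<rbrakk> \<Longrightarrow> x \<otimes> c = \<zero>"
  by (simp add: right_center_def)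

text \<open>In the Leibniz identity for \<open>x\<close>, \<open>c\<close>, \<open>y\<close> the
  terms \<open>(x \<otimes> c) \<otimes> y\<close> and \<open>(x \<otimes> y) \<otimes> c\<close>
  vanish, which leaves \<open>x \<otimes> (c \<otimes> y) = \<zero>\<close>.\<close>

lemma right_center_mult:
  assumes "c \<in> right_center A" "y \<in> carrier A"
  shows "c \<otimes> y \<in> right_center A"
proof -
  have c: "c \<in> carrier A"
    using assms(1) by (simp add: right_center_def)
  have "x \<otimes> (c \<otimes> y) = \<zero>" if x: "x \<in> carrier A" for x
  proof -
    have "(x \<otimes> c) \<otimes> y = (x \<otimes> y) \<otimes> c \<oplus> x \<otimes> (c \<otimes> y)"
      using x c assms(2) by (rule right_leibniz)
    moreover have "x \<otimes> c = \<zero>" "(x \<otimes> y) \<otimes> c = \<zero>"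
      using x assms by (simp_all add: mult_right_center mult_closed)
    ultimately show ?thesis
      using x c assms(2) by (simp add: mult_closed mult_zero_left)
  qed
  then show ?thesis
    using assms by (simp add: right_center_def mult_closed)
qed

lemma square_in_right_center:
  assumes "x \<in> carrier A"
  shows "x \<otimes> x \<in> right_center A"
proof -
  have "y \<otimes> (x \<otimes> x) = \<zero>" if "y \<in> carrier A" for y
    using right_leibniz[OF that assms assms] assms that by (simp add: mult_closed)
  then show ?thesis
    using assms by (simp add: right_center_def mult_closed)
qed

section \<open>The Leibniz kernel as an ideal inside the right center\<close>

lemma leibniz_kernel_submodule: "submodule (leibniz_kernel F A) F A"
  unfolding leibniz_kernel_def by (rule lin_span_submodule) (auto intro: mult_closed)

lemma leibniz_kernel_subset_right_center: "leibniz_kernel F A \<subseteq> right_center A"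
  unfolding leibniz_kernel_def
  by (rule lin_span_least[OF right_center_submodule]) (auto intro: square_in_right_center)

lemma square_in_leibniz_kernel: "x \<in> carrier A \<Longrightarrow> x \<otimes> x \<in> leibniz_kernel F A"
  unfolding leibniz_kernel_def by (rule subsetD[OF lin_span_superset]) blast

text \<open>Polarization: the sum is the square of \<open>x \<oplus> y\<close> minus the squares of
  \<open>x\<close> and \<open>y\<close>.\<close>

lemma anticommutator_in_leibniz_kernel:
  assumes x: "x \<in> carrier A" and y: "y \<in> carrier A"
  shows "x \<otimes> y \<oplus> y \<otimes> x \<in> leibniz_kernel F A"
proof -
  note K = submoduleE[OF leibniz_kernel_submodule]
  let ?s = "(x \<oplus> y) \<otimes> (x \<oplus> y)"
  have "?s = (x \<otimes> x \<oplus> y \<otimes> y) \<oplus> (x \<otimes> y \<oplus> y \<otimes> x)"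
    using x y by (simp add: mult_add_left mult_add_right mult_closed M.a_ac)
  then have "x \<otimes> y \<oplus> y \<otimes> x = \<ominus> (x \<otimes> x \<oplus> y \<otimes> y) \<oplus> ?s"
    using x y by (simp add: mult_closed M.r_neg1)
  moreover have "\<ominus> (x \<otimes> x \<oplus> y \<otimes> y) \<oplus> ?s \<in> leibniz_kernel F A"
    using x y by (intro K square_in_leibniz_kernel M.a_closed)
  ultimately show ?thesis
    by simp
qed

text \<open>As \<open>c\<close> lies in the right center, \<open>y \<otimes> c\<close> is zero, so
  \<open>c \<otimes> y\<close> equals the anticommutator of \<open>c\<close> and
  \<open>y\<close>.\<close>

lemma leibniz_kernel_mult:
  assumes c: "c \<in> leibniz_kernel F A" and y: "y \<in> carrier A"
  shows "c \<otimes> y \<in> leibniz_kernel F A"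
proof -
  have "c \<in> carrier A"
    using c submoduleE(1)[OF leibniz_kernel_submodule] by blast
  moreover have "y \<otimes> c = \<zero>"
    using c y leibniz_kernel_subset_right_center mult_right_center by blast
  ultimately show ?thesis
    using anticommutator_in_leibniz_kernel[of c y] y by (simp add: mult_closed)
qed

lemma mult_leibniz_kernel:
  assumes "x \<in> carrier A" "c \<in> leibniz_kernel F A"
  shows "x \<otimes> c \<in> leibniz_kernel F A"
proof -
  have "x \<otimes> c = \<zero>"
    using assms leibniz_kernel_subset_right_center mult_right_center by blast
  then show ?thesis
    using zero_in_submodule[OF leibniz_kernel_submodule] by simp
qed

section \<open>The Lie algebra of right multiplications\<close>

lemma right_mult_surj_algebra_hom:
  "surj_algebra_hom F A (right_mult_algebra F A) (\<lambda>a. right_mult_op A (\<ominus> a))"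
proof unfold_locales
  show "(\<lambda>a. right_mult_op A (\<ominus> a)) ` carrier A = carrier (right_mult_algebra F A)"
  proof -
    \<comment> \<open>Negation permutes the carrier, so the sign in the map does not shrink its
      image.\<close>
    have "(\<lambda>a. \<ominus> a) ` carrier A = carrier A"
    proof
      show "carrier A \<subseteq> (\<lambda>a. \<ominus> a) ` carrier A"
        by (metis M.a_inv_closed M.minus_minus image_eqI subsetI)
    qed auto
    then have "right_mult_op A ` (\<lambda>a. \<ominus> a) ` carrier A = right_mult_op A ` carrier A"
      by simp
    then show ?thesis
      by (simp add: image_image right_mult_algebra_def)
  qed
  show "right_mult_op A (\<ominus> \<zero>) = \<zero>\<^bsub>right_mult_algebra F A\<^esub>"
    by (auto simp: right_mult_algebra_def gl_def right_mult_op_def mult_zero_right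
        minus_zero intro!: restrict_ext)
  fix x y assume x: "x \<in> carrier A" and y: "y \<in> carrier A"
  show "right_mult_op A (\<ominus> (x \<oplus> y)) =
      right_mult_op A (\<ominus> x) \<oplus>\<^bsub>right_mult_algebra F A\<^esub> right_mult_op A (\<ominus> y)"
    using x y by (auto simp: right_mult_algebra_def gl_def right_mult_op_def M.minus_add
        mult_add_right intro!: restrict_ext)
  show "right_mult_op A (\<ominus> (x \<otimes> y)) =
      right_mult_op A (\<ominus> x) \<otimes>\<^bsub>right_mult_algebra F A\<^esub> right_mult_op A (\<ominus> y)"
  proof -
    \<comment> \<open>The commutator evaluated at \<open>z\<close>: the signs on the right cancel in
      pairs, giving \<open>(z \<otimes> y) \<otimes> x \<ominus> (z \<otimes> x) \<otimes>
      y\<close>, which is \<open>\<ominus> (z \<otimes> (x \<otimes> y))\<close> by the Leibniz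
      identity. Without the sign in the map, the order of the factors would be reversed.\<close>
    have "z \<otimes> \<ominus> (x \<otimes> y) = (z \<otimes> \<ominus> y) \<otimes> \<ominus> x \<ominus> (z \<otimes> \<ominus> x) \<otimes> \<ominus> y"
      if z: "z \<in> carrier A" for z
    proof -
      have "(z \<otimes> x) \<otimes> y = (z \<otimes> y) \<otimes> x \<oplus> z \<otimes> (x \<otimes> y)"
        using x y z by (intro right_leibniz)
      then show ?thesis
        using x y z
        by (simp add: mult_minus_right mult_minus_left mult_closed M.minus_eq M.minus_add
            M.r_neg2)
    qed
    then show ?thesis
      using x y by (auto simp: right_mult_algebra_def gl_def right_mult_op_def mult_closed
          intro!: restrict_ext)
  qed
next
  fix a x assume "a \<in> carrier F" "x \<in> carrier A"
  then show "right_mult_op A (\<ominus> (a \<odot> x)) =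
      a \<odot>\<^bsub>right_mult_algebra F A\<^esub> right_mult_op A (\<ominus> x)"
    by (auto simp: right_mult_algebra_def gl_def right_mult_op_def mult_smult_right
        intro!: restrict_ext simp flip: smult_r_minus)
qed

lemma solvable_right_mult_algebra_iff:
  "solvable_algebra F A \<longleftrightarrow> solvable_algebra F (right_mult_algebra F A)"
proof -
  interpret surj_algebra_hom F A "right_mult_algebra F A" "\<lambda>a. right_mult_op A (\<ominus> a)"
    by (rule right_mult_surj_algebra_hom)
  have "c \<in> right_center A"
    if c: "c \<in> carrier A" and z: "right_mult_op A (\<ominus> c) = \<zero>\<^bsub>right_mult_algebra F A\<^esub>" for c
  proof -
    have "x \<otimes> c = \<zero>" if x: "x \<in> carrier A" for x
    proof -
      \<comment> \<open>The equality of operators is evaluated at \<open>x\<close>, where both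
        restrictions unfold because \<open>x\<close> is in the carrier.\<close>
      have "\<ominus> (x \<otimes> c) = \<zero>"
        using fun_cong[OF z, of x] x c
        by (simp add: right_mult_algebra_def gl_def right_mult_op_def mult_minus_right)
      then show ?thesis
        using x c by (metis M.minus_minus minus_zero mult_closed)
    qed
    then show ?thesis
      using c by (simp add: right_center_def)
  qed
  then show ?thesis
    by (rule solvable_iff)
qed

end

theorem proposition6p2:
  fixes F :: "('f, 'p) ring_scheme" and L :: "('f, 'a, 'q) module_scheme"
  assumes "right_leibniz_algebra F L"
  shows "(solvable_algebra F L \<longleftrightarrow> solvable_algebra F (canonical_lie F L)) \<and>
         (solvable_algebra F L \<longleftrightarrow> solvable_algebra F (quotient_algebra L (right_center L))) \<and>
         (solvable_algebra F L \<longleftrightarrow> solvable_algebra F (right_mult_algebra F L))"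
proof -
  interpret right_leibniz_algebra F L by (rule assms)
  have "solvable_algebra F L \<longleftrightarrow> solvable_algebra F (canonical_lie F L)"
    unfolding canonical_lie_def
    using leibniz_kernel_submodule mult_leibniz_kernel leibniz_kernel_mult
      leibniz_kernel_subset_right_center
    by (rule solvable_quotient_iff)
  \<comment> \<open>The right center absorbs products from the left trivially, since these are zero;
    absorption from the right is \<open>right_center_mult\<close>.\<close>
  moreover have "solvable_algebra F L \<longleftrightarrow> solvable_algebra F (quotient_algebra L (right_center L))"
    using right_center_submodule
    by (rule solvable_quotient_iff)
      (simp_all add: mult_right_center right_center_mult zero_in_submodule right_center_submodule)
  ultimately show ?thesis
    using solvable_right_mult_algebra_iff by blast
qed

end
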